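(* Let $(U,V)$ be a pair in $SO(p)\times SO(p)$ that is not sign-change reducible. Then there exist $D,\Lambda\in\mathrm{Diag}^+(p)$, each having pairwise distinct diagonal entries, such that the pair $((U,D),(V,\Lambda))$ is minimal.
   Context: Let $p\ge2$. $\mathrm{Sym}^+(p)$ is the set of $p\times p$ real symmetric positive-definite matrices, $\mathrm{Diag}^+(p)$ the set of $p\times p$ diagonal matrices with positive diagonal entries, $M(p)=SO(p)\times \mathrm{Diag}^+(p)$, $F(U,D)=UDU^T$, and $\mathcal{E}_X=F^{-1}(X)$. (The matrices in $\mathrm{Diag}^+(p)$ with pairwise distinct diagonal entries form the top stratum of $\mathrm{Diag}^+(p)$.) $SO(p)$ carries the bi-invariant Riemannian metric $g_{SO}$ given at the identity by $g_{SO}(A_1,A_2)=-\frac12\mathrm{tr}(A_1A_2)$, with geodesic distance $d_{SO}$; $\mathrm{Diag}^+(p)$ carries $g_{\mathcal{D}^+}|_D(L_1,L_2)=\mathrm{tr}(D^{-1}L_1D^{-1}L_2)$; $M(p)$ carries $g_M=k\,g_{SO}\oplus g_{\mathcal{D}^+}$ with fixed $k>0$ and geodesic distance $d_M$, so $d_M((U,D),(V,\Lambda))^2=k\,d_{SO}(U,V)^2+\|\log(D^{-1}\Lambda)\|_F^2$. A pair $(a,b)\in M(p)\times M(p)$ is minimal if, with $X=F(a)$ and $Y=F(b)$, $d_M(a,b)=d_{\mathcal{SR}}(X,Y):=\inf\{d_M(a',b'):a'\in\mathcal{E}_X,b'\in\mathcal{E}_Y\}$ (equivalently, $a,b$ are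 the endpoints of a geodesic of minimal length among those from $\mathcal{E}_X$ to $\mathcal{E}_Y$). $\mathcal{I}_p^+=\{\sigma\in\{\pm1\}^p:\prod_i\sigma_i=1\}$ and $I_\sigma=\mathrm{diag}(\sigma_1,\dots,\sigma_p)$. A pair $(U,V)\in SO(p)\times SO(p)$ is sign-change reducible if $d_{SO}(UI_\sigma,V)<d_{SO}(U,V)$ for some $\sigma\in\mathcal{I}_p^+$. *)

theory Defs
  imports "HOL-Analysis.Analysis"
begin

section \<open>Geodesic distance of an embedded Riemannian manifold\<close>

text \<open>
  A Riemannian metric on a submanifold \<open>S\<close> of a Euclidean space is represented by a function
  \<open>g\<close>, where \<open>g x v w\<close> is the inner product of the tangent vectors \<open>v\<close> and \<open>w\<close> at the point
  \<open>x \<in> S\<close>.  Only the values at points of \<open>S\<close> and at vectors tangent to \<open>S\<close> matter, and the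
  velocity of a path inside \<open>S\<close> is such a vector.
\<close>

definition riem_speed ::
  "('a::real_normed_vector \<Rightarrow> 'a \<Rightarrow> 'a \<Rightarrow> real) \<Rightarrow> (real \<Rightarrow> 'a) \<Rightarrow> real \<Rightarrow> real" where
  "riem_speed g \<gamma> t =
     sqrt (g (\<gamma> t) (vector_derivative \<gamma> (at t)) (vector_derivative \<gamma> (at t)))"

definition riem_length ::
  "('a::real_normed_vector \<Rightarrow> 'a \<Rightarrow> 'a \<Rightarrow> real) \<Rightarrow> (real \<Rightarrow> 'a) \<Rightarrow> real" where
  "riem_length g \<gamma> = integral {0..1} (riem_speed g \<gamma>)"

text \<open>
  \<^const>\<open>valid_path\<close> asks for a continuous path that is continuously differentiable off a finite
  set, but it allows the derivative to be unbounded near that set.  Such a path may have infinite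
  length, for which the value of \<^const>\<open>integral\<close> would be \<open>0\<close>; hence the integrability
  condition, which every piecewise continuously differentiable path in the usual sense satisfies.
  The infimum is taken in the reals and is meaningful when \<open>a\<close> and \<open>b\<close> can be joined in \<open>S\<close>;
  the manifolds below are connected.
\<close>

definition riem_dist ::
  "'a::real_normed_vector set \<Rightarrow> ('a \<Rightarrow> 'a \<Rightarrow> 'a \<Rightarrow> real) \<Rightarrow> 'a \<Rightarrow> 'a \<Rightarrow> real" where
  "riem_dist S g a b =
     Inf {riem_length g \<gamma> | \<gamma>.
            valid_path \<gamma> \<and> riem_speed g \<gamma> integrable_on {0..1} \<and>
            path_image \<gamma> \<subseteq> S \<and> pathstart \<gamma> = a \<and> pathfinish \<gamma> = b}"


section \<open>The manifolds and their metrics\<close>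

definition SO :: "(real ^ 'n ^ 'n) set" where
  "SO = {U. rotation_matrix U}"

definition DiagPos :: "(real ^ 'n ^ 'n) set" where
  "DiagPos = {D. (\<forall>i j. i \<noteq> j \<longrightarrow> D $ i $ j = 0) \<and> (\<forall>i. D $ i $ i > 0)}"

definition M_space :: "((real ^ 'n ^ 'n) \<times> (real ^ 'n ^ 'n)) set" where
  "M_space = SO \<times> DiagPos"

definition g_SO_id :: "real ^ 'n ^ 'n \<Rightarrow> real ^ 'n ^ 'n \<Rightarrow> real" where
  "g_SO_id A1 A2 = - (1 / 2) * trace (A1 ** A2)"

text \<open>
  The left-invariant extension of \<open>g_SO_id\<close>: a tangent vector at \<open>U\<close> is moved to the identity by
  left multiplication with \<open>U\<inverse> = U\<^sup>T\<close>.  As \<open>g_SO_id\<close> is invariant under conjugation by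
  \<open>SO\<close>, this is the bi-invariant metric.
\<close>

definition g_SO :: "real ^ 'n ^ 'n \<Rightarrow> real ^ 'n ^ 'n \<Rightarrow> real ^ 'n ^ 'n \<Rightarrow> real" where
  "g_SO U A1 A2 = g_SO_id (transpose U ** A1) (transpose U ** A2)"

definition g_Diag :: "real ^ 'n ^ 'n \<Rightarrow> real ^ 'n ^ 'n \<Rightarrow> real ^ 'n ^ 'n \<Rightarrow> real" where
  "g_Diag D L1 L2 = trace (matrix_inv D ** L1 ** matrix_inv D ** L2)"

definition g_M ::
  "real \<Rightarrow> (real ^ 'n ^ 'n) \<times> (real ^ 'n ^ 'n) \<Rightarrow> (real ^ 'n ^ 'n) \<times> (real ^ 'n ^ 'n)
     \<Rightarrow> (real ^ 'n ^ 'n) \<times> (real ^ 'n ^ 'n) \<Rightarrow> real" where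
  "g_M k a v w =
     k * g_SO (fst a) (fst v) (fst w) + g_Diag (snd a) (snd v) (snd w)"

definition d_SO :: "real ^ 'n ^ 'n \<Rightarrow> real ^ 'n ^ 'n \<Rightarrow> real" where
  "d_SO = riem_dist SO g_SO"

definition d_M ::
  "real \<Rightarrow> (real ^ 'n ^ 'n) \<times> (real ^ 'n ^ 'n) \<Rightarrow> (real ^ 'n ^ 'n) \<times> (real ^ 'n ^ 'n) \<Rightarrow> real" where
  "d_M k = riem_dist M_space (g_M k)"


section \<open>Fibers of the eigen-composition map and minimal pairs\<close>

definition F_map :: "(real ^ 'n ^ 'n) \<times> (real ^ 'n ^ 'n) \<Rightarrow> real ^ 'n ^ 'n" where
  "F_map = (\<lambda>(U, D). U ** D ** transpose U)"

definition fiber :: "real ^ 'n ^ 'n \<Rightarrow> ((real ^ 'n ^ 'n) \<times> (real ^ 'n ^ 'n)) set" where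
  "fiber X = {a \<in> M_space. F_map a = X}"

definition d_SR :: "real \<Rightarrow> real ^ 'n ^ 'n \<Rightarrow> real ^ 'n ^ 'n \<Rightarrow> real" where
  "d_SR k X Y = Inf {d_M k a b | a b. a \<in> fiber X \<and> b \<in> fiber Y}"

definition minimal_pair ::
  "real \<Rightarrow> (real ^ 'n ^ 'n) \<times> (real ^ 'n ^ 'n) \<Rightarrow> (real ^ 'n ^ 'n) \<times> (real ^ 'n ^ 'n) \<Rightarrow> bool" where
  "minimal_pair k a b \<longleftrightarrow> a \<in> M_space \<and> b \<in> M_space \<and> d_M k a b = d_SR k (F_map a) (F_map b)"


section \<open>Sign changes\<close>

definition even_signs :: "('n::finite \<Rightarrow> real) set" where
  "even_signs = {\<sigma>. (\<forall>i. \<sigma> i \<in> {-1, 1}) \<and> (\<Prod>i\<in>UNIV. \<sigma> i) = 1}"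

definition sign_matrix :: "('n \<Rightarrow> real) \<Rightarrow> real ^ 'n ^ 'n" where
  "sign_matrix \<sigma> = (\<chi> i j. if i = j then \<sigma> i else 0)"

definition sign_change_reducible :: "real ^ 'n ^ 'n \<Rightarrow> real ^ 'n ^ 'n \<Rightarrow> bool" where
  "sign_change_reducible U V \<longleftrightarrow>
     (\<exists>\<sigma>\<in>even_signs. d_SO (U ** sign_matrix \<sigma>) V < d_SO U V)"

end

theory Submission
  imports Defs
begin

text \<open>
  Take \<open>\<Lambda> = D\<close>, with the logarithms of the diagonal entries of \<open>D\<close> so far apart that any two of them
  differ by at least \<open>c = sqrt k * d_SO U V\<close>.  Moving only the orthogonal factor along a path from
  \<open>U\<close> to \<open>V\<close> gives \<open>d_M ((U, D), (V, D)) \<le> c\<close> (lemma \<open>d_M_equal_diagonal_le\<close>).  It remains to see that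
  every path from a point \<open>(U', D')\<close> of the first fiber to a point \<open>(V', \<Lambda>')\<close> of the second
  has length at least \<open>c\<close>.  The rotations \<open>W\<^sub>1 = U\<^sup>T U'\<close> and \<open>W\<^sub>2 = V\<^sup>T V'\<close> satisfy \<open>W\<^sub>1 D' = D W\<^sub>1\<close> and
  \<open>W\<^sub>2 \<Lambda>' = D W\<^sub>2\<close>, so that all diagonal entries of \<open>D'\<close> and \<open>\<Lambda>'\<close> are diagonal
  entries of \<open>D\<close>.

  If \<open>D'\<close> and \<open>\<Lambda>'\<close> differ in some position, their entries there are two different entries of \<open>D\<close>.
  The logarithm of that entry then changes by at least \<open>c\<close> along the path, and its total
  change is a lower bound for the length (lemma \<open>M_length_ge_log\<close>).

  If \<open>D' = \<Lambda>'\<close>, then \<open>S = W\<^sub>1 W\<^sub>2\<^sup>T\<close> commutes with \<open>D\<close>, so it is an even sign matrix.  Since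
  \<open>U S = U' W\<^sub>2\<^sup>T\<close> and \<open>V = V' W\<^sub>2\<^sup>T\<close>, irreducibility and right invariance give
  \<open>d_SO U V \<le> d_SO (U S) V \<le> d_SO U' V'\<close>, and the length of the path is at least
  \<open>sqrt k * d_SO U' V'\<close> (lemma \<open>M_length_ge_SO_distance\<close>).

  These bounds compare infima over sets of paths, which is sound only if the sets are nonempty; this
  is why the connectedness of \<open>SO\<close> by smooth paths is established first.
\<close>

section \<open>The rotation group is connected by smooth paths\<close>

lemma bounded_bilinear_matrix_mult:
  "bounded_bilinear ((**) :: real^'n^'n \<Rightarrow> real^'n^'n \<Rightarrow> real^'n^'n)"
proof -
  have "bilinear ((**) :: real^'n^'n \<Rightarrow> real^'n^'n \<Rightarrow> real^'n^'n)"
    unfolding bilinear_def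
    by (auto intro!: linearI simp: vec_eq_iff matrix_matrix_mult_def sum_distrib_left algebra_simps
        sum.distrib)
  then show ?thesis by (simp add: bilinear_conv_bounded_bilinear)
qed

lemma bounded_linear_transpose: "bounded_linear (transpose :: real^'n^'n \<Rightarrow> real^'n^'n)"
  by (intro linear_conv_bounded_linear[THEN iffD1] linearI) (auto simp: transpose_def vec_eq_iff)

lemma SO_iff: "U \<in> SO \<longleftrightarrow> transpose U ** U = mat 1 \<and> det U = 1"
  by (simp add: SO_def rotation_matrix_def orthogonal_matrix)

lemma SO_transpose_mult: "U \<in> SO \<Longrightarrow> transpose U ** U = mat 1"
  and SO_mult_transpose: "U \<in> SO \<Longrightarrow> U ** transpose U = mat 1"
  by (simp_all add: SO_def rotation_matrix_def orthogonal_matrix_def)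

lemma SO_mult: "U \<in> SO \<Longrightarrow> V \<in> SO \<Longrightarrow> U ** V \<in> SO"
  by (simp add: SO_def rotation_matrix_def orthogonal_matrix_mul det_mul)

lemma SO_transpose: "U \<in> SO \<Longrightarrow> transpose U \<in> SO"
  by (simp add: SO_def rotation_matrix_def)

lemma C1_differentiable_on_matrix_mult:
  fixes f g :: "real \<Rightarrow> real^'n^'n"
  assumes "f C1_differentiable_on S" "g C1_differentiable_on S"
  shows "(\<lambda>t. f t ** g t) C1_differentiable_on S"
proof -
  interpret mm: bounded_bilinear "(**) :: real^'n^'n \<Rightarrow> real^'n^'n \<Rightarrow> real^'n^'n"
    by (rule bounded_bilinear_matrix_mult)
  obtain f' g' where f': "\<And>t. t \<in> S \<Longrightarrow> (f has_vector_derivative f' t) (at t)" "continuous_on S f'"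
    and g': "\<And>t. t \<in> S \<Longrightarrow> (g has_vector_derivative g' t) (at t)" "continuous_on S g'"
    using assms unfolding C1_differentiable_on_def by blast
  have fg: "continuous_on S f" "continuous_on S g"
    using f'(1) g'(1)
    by (auto intro!: continuous_at_imp_continuous_on has_vector_derivative_continuous)
  show ?thesis
    unfolding C1_differentiable_on_def
  proof (intro exI conjI ballI)
    show "((\<lambda>t. f t ** g t) has_vector_derivative f t ** g' t + f' t ** g t) (at t)" if "t \<in> S" for t
      by (rule mm.has_vector_derivative[OF f'(1) g'(1)]) (use that in auto)
    show "continuous_on S (\<lambda>t. f t ** g' t + f' t ** g t)"
      by (intro continuous_on_add mm.continuous_on fg f' g')
  qed
qed

text \<open>
  For orthonormal \<open>p\<close>, \<open>q\<close> this is the rotation by \<open>\<theta>\<close> in the plane they span, turning \<open>p\<close> towards \<open>q\<close>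
  and fixing the orthogonal complement of that plane.  It is affine in \<open>cos \<theta>\<close> and \<open>sin \<theta>\<close>, which
  makes it a smooth path in \<open>\<theta>\<close> at no cost.
\<close>

definition plane_rotation :: "real^'n \<Rightarrow> real^'n \<Rightarrow> real \<Rightarrow> real^'n^'n" where
  "plane_rotation p q \<theta> = mat 1
     + (cos \<theta> - 1) *\<^sub>R (\<chi> i j. p$i * p$j + q$i * q$j)
     + sin \<theta> *\<^sub>R (\<chi> i j. q$i * p$j - p$i * q$j)"

lemma plane_rotation_mult_vec:
  "plane_rotation p q \<theta> *v z = z + (cos \<theta> - 1) *\<^sub>R ((p \<bullet> z) *\<^sub>R p + (q \<bullet> z) *\<^sub>R q)
     + sin \<theta> *\<^sub>R ((p \<bullet> z) *\<^sub>R q - (q \<bullet> z) *\<^sub>R p)"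
proof -
  have 1: "(\<chi> i j. p$i * p$j + q$i * q$j) *v z = (p \<bullet> z) *\<^sub>R p + (q \<bullet> z) *\<^sub>R q"
    by (auto simp: vec_eq_iff matrix_vector_mult_def inner_vec_def algebra_simps sum.distrib sum_distrib_left)
  have 2: "(\<chi> i j. q$i * p$j - p$i * q$j) *v z = (p \<bullet> z) *\<^sub>R q - (q \<bullet> z) *\<^sub>R p"
    by (auto simp: vec_eq_iff matrix_vector_mult_def inner_vec_def algebra_simps sum_subtractf sum_distrib_left)
  show ?thesis
    unfolding plane_rotation_def
    by (simp add: matrix_vector_mult_add_rdistrib flip: scaleR_matrix_vector_assoc 1 2)
qed

lemma orthogonal_matrix_plane_rotation:
  assumes "norm p = 1" "norm q = 1" "p \<bullet> q = 0"
  shows "orthogonal_matrix (plane_rotation p q \<theta>)"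
proof -
  have pq: "p \<bullet> p = 1" "q \<bullet> q = 1" "p \<bullet> q = 0" "q \<bullet> p = 0"
    using assms by (auto simp: norm_eq_1 inner_commute)
  have "norm (plane_rotation p q \<theta> *v z) = norm z" for z
  proof -
    define a b where "a = p \<bullet> z" and "b = q \<bullet> z"
    have ab: "z \<bullet> p = a" "z \<bullet> q = b" by (simp_all add: a_def b_def inner_commute)
    define \<alpha> \<beta> where "\<alpha> = (cos \<theta> - 1) * a - sin \<theta> * b" and "\<beta> = (cos \<theta> - 1) * b + sin \<theta> * a"
    have eq: "plane_rotation p q \<theta> *v z = z + (\<alpha> *\<^sub>R p + \<beta> *\<^sub>R q)"
      unfolding plane_rotation_mult_vec a_def[symmetric] b_def[symmetric] \<alpha>_def \<beta>_def
      by (simp add: algebra_simps)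
    have "(plane_rotation p q \<theta> *v z) \<bullet> (plane_rotation p q \<theta> *v z) =
        z \<bullet> z + 2 * (\<alpha> * a + \<beta> * b) + \<alpha>\<^sup>2 + \<beta>\<^sup>2"
      unfolding eq using pq ab
      by (simp add: inner_add_left inner_add_right inner_commute power2_eq_square algebra_simps)
    also have "\<dots> = z \<bullet> z + (a\<^sup>2 + b\<^sup>2) * ((cos \<theta>)\<^sup>2 + (sin \<theta>)\<^sup>2 - 1)"
      unfolding \<alpha>_def \<beta>_def by algebra
    finally show ?thesis by (simp add: norm_eq)
  qed
  then have "orthogonal_transformation ((*v) (plane_rotation p q \<theta>))"
    by (simp add: orthogonal_transformation)
  then show ?thesis
    by (simp add: orthogonal_transformation_matrix)
qed

lemma continuous_on_det:
  fixes f :: "'a::topological_space \<Rightarrow> real^'n^'n"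
  assumes "continuous_on S f"
  shows "continuous_on S (\<lambda>x. det (f x))"
  unfolding det_def by (intro continuous_intros assms)

lemma C1_differentiable_on_plane_rotation:
  "(\<lambda>t. plane_rotation p q (t * \<theta>)) C1_differentiable_on S"
proof -
  have "(\<lambda>t. cos (t * \<theta>)) C1_differentiable_on S" "(\<lambda>t. sin (t * \<theta>)) C1_differentiable_on S"
    unfolding C1_differentiable_on_def
    by (rule exI[of _ "\<lambda>t. - sin (t * \<theta>) * \<theta>"] exI[of _ "\<lambda>t. cos (t * \<theta>) * \<theta>"],
        auto intro!: derivative_eq_intros continuous_intros simp flip: has_real_derivative_iff_has_vector_derivative)+
  then show ?thesis
    unfolding plane_rotation_def by simp
qed

text \<open>
  The determinant is a continuous function of the angle with values in \<open>{1, -1}\<close>, so it keeps the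
  value \<open>1\<close> that it has at angle \<open>0\<close>.
\<close>

lemma plane_rotation_in_SO:
  assumes "norm p = 1" "norm q = 1" "p \<bullet> q = 0"
  shows "plane_rotation p q \<theta> \<in> SO"
proof -
  have "continuous_on UNIV (plane_rotation p q)"
    unfolding plane_rotation_def by (intro continuous_intros)
  then have "continuous_on UNIV (\<lambda>t. det (plane_rotation p q t))"
    by (rule continuous_on_det)
  moreover have "range (\<lambda>t. det (plane_rotation p q t)) \<subseteq> {1, -1}"
    using det_orthogonal_matrix[OF orthogonal_matrix_plane_rotation[OF assms]] by auto
  then have "finite (range (\<lambda>t. det (plane_rotation p q t)))"
    by (rule finite_subset) auto
  ultimately have "(\<lambda>t. det (plane_rotation p q t)) constant_on UNIV"
    by (intro continuous_finite_range_constant connected_UNIV)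
  then have "det (plane_rotation p q \<theta>) = det (plane_rotation p q 0)"
    unfolding constant_on_def by (metis UNIV_I)
  also have "\<dots> = 1" by (simp add: plane_rotation_def)
  finally show ?thesis
    by (simp add: SO_def rotation_matrix_def orthogonal_matrix_plane_rotation[OF assms])
qed

text \<open>
  Asking for a single \<open>C\<^sup>1\<close> path, rather than a piecewise one, avoids reparametrisation: two such
  paths are combined by their pointwise product, not by concatenation.  The path is defined on the
  whole line because \<^const>\<open>C1_differentiable_on\<close> asks for two-sided derivatives, also at the end
  points of the unit interval.
\<close>

definition C1_joined_to_id :: "real^'n^'n \<Rightarrow> bool" where
  "C1_joined_to_id U \<longleftrightarrow>
     (\<exists>\<gamma>. \<gamma> C1_differentiable_on UNIV \<and> (\<forall>t. \<gamma> t \<in> SO) \<and> \<gamma> 0 = mat 1 \<and> \<gamma> 1 = U)"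

lemma C1_joined_to_id_mult:
  assumes "C1_joined_to_id U" "C1_joined_to_id V"
  shows "C1_joined_to_id (U ** V)"
proof -
  obtain \<gamma> \<delta> where "\<gamma> C1_differentiable_on UNIV" "\<forall>t. \<gamma> t \<in> SO" "\<gamma> 0 = mat 1" "\<gamma> 1 = U"
    "\<delta> C1_differentiable_on UNIV" "\<forall>t. \<delta> t \<in> SO" "\<delta> 0 = mat 1" "\<delta> 1 = V"
    using assms unfolding C1_joined_to_id_def by blast
  then show ?thesis
    unfolding C1_joined_to_id_def
    by (intro exI[of _ "\<lambda>t. \<gamma> t ** \<delta> t"]) (auto intro: C1_differentiable_on_matrix_mult SO_mult)
qed

lemma C1_joined_to_id_plane_rotation:
  assumes "norm p = 1" "norm q = 1" "p \<bullet> q = 0"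
  shows "C1_joined_to_id (plane_rotation p q \<theta>)"
  unfolding C1_joined_to_id_def
proof (intro exI conjI allI)
  show "(\<lambda>t. plane_rotation p q (t * \<theta>)) C1_differentiable_on UNIV"
    by (rule C1_differentiable_on_plane_rotation)
  show "plane_rotation p q (t * \<theta>) \<in> SO" for t
    by (rule plane_rotation_in_SO[OF assms])
qed (simp_all add: plane_rotation_def)

lemma SO_preserves_inner:
  assumes "U \<in> SO"
  shows "(U *v x) \<bullet> (U *v y) = x \<bullet> y"
proof -
  have "(U *v x) \<bullet> (U *v y) = x \<bullet> ((transpose U ** U) *v y)"
    by (simp add: dot_lmul_matrix flip: matrix_vector_mul_assoc)
      (metis dot_lmul_matrix inner_commute)
  then show ?thesis using SO_transpose_mult[OF assms] by simp
qed

text \<open>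
  Elimination by plane rotations.  If \<open>U\<close> moves the basis vector \<open>e\<^sub>j\<close> to \<open>y\<close>, then \<open>y\<close> is orthogonal
  to all basis vectors that \<open>U\<close> fixes, so some plane rotation \<open>G\<close> takes \<open>e\<^sub>j\<close> to \<open>y\<close> and fixes those
  vectors; then \<open>G\<^sup>T U\<close> fixes one more basis vector.  The determinant enters when \<open>y = -e\<^sub>j\<close>:
  a plane for the half turn has to be spanned by \<open>e\<^sub>j\<close> and another basis vector that is not yet fixed.
\<close>

lemma C1_joined_to_id_SO:
  fixes U :: "real^'n^'n"
  assumes "U \<in> SO"
  shows "C1_joined_to_id U"
  using assms
proof (induction "card {i. U *v axis i 1 \<noteq> axis i 1}" arbitrary: U rule: less_induct)
  case less
  define M where "M = {i. U *v axis i 1 \<noteq> axis i 1}"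
  show ?case
  proof (cases "M = {}")
    case True
    then have "U *v axis i 1 = mat 1 *v axis i 1" for i
      by (auto simp: M_def)
    then have "U = mat 1"
      by (simp add: vec_eq_iff matrix_vector_mult_basis column_def)
    then show ?thesis
      unfolding C1_joined_to_id_def by (intro exI[of _ "\<lambda>t. mat 1"]) (simp add: SO_iff)
  next
    case False
    then obtain j where j: "j \<in> M" by blast
    define y where "y = U *v axis j 1"
    have ortho: "y $ i = 0" if "i \<notin> M" for i
    proof -
      have "y \<bullet> (U *v axis i 1) = axis j 1 \<bullet> axis i (1::real)"
        unfolding y_def by (rule SO_preserves_inner[OF less.prems])
      moreover have "i \<noteq> j" using that j by auto
      ultimately show ?thesis using that by (simp add: M_def inner_axis) (simp add: axis_def)
    qed
    have yy: "y \<bullet> y = 1"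
      unfolding y_def SO_preserves_inner[OF less.prems] by (simp add: inner_axis_axis)
    \<comment> \<open>The component of \<open>y\<close> orthogonal to \<open>e\<^sub>j\<close>: it determines the plane unless it vanishes.\<close>
    define w where "w = y - (y $ j) *\<^sub>R axis j 1"
    have wj: "w $ j = 0" by (simp add: w_def)
    have w0: "w $ i = 0" if "i \<notin> M" for i
      using ortho[OF that] that j by (auto simp: w_def axis_def)
    have "w \<bullet> w = y \<bullet> y - (y $ j) * (y $ j)"
      by (simp add: w_def inner_diff_left inner_diff_right inner_axis inner_axis' inner_axis_axis)
    then have ww: "(y $ j)\<^sup>2 + (norm w)\<^sup>2 = 1"
      using yy by (simp add: power2_norm_eq_inner) (simp add: power2_eq_square)
    obtain q \<theta> where q: "norm q = 1" "q $ j = 0" "\<And>i. i \<notin> M \<Longrightarrow> q $ i = 0"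
      and y: "y = cos \<theta> *\<^sub>R axis j 1 + sin \<theta> *\<^sub>R q"
    proof (cases "w = 0")
      case False
      obtain \<theta> where \<theta>: "y $ j = cos \<theta>" "norm w = sin \<theta>"
        using sincos_total_2pi[OF ww] by metis
      show ?thesis
      proof (rule that)
        show "y = cos \<theta> *\<^sub>R axis j 1 + sin \<theta> *\<^sub>R ((1 / norm w) *\<^sub>R w)"
          using False by (simp add: w_def flip: \<theta>)
      qed (use False wj w0 in auto)
    next
      case True
      then have yj: "y = (y $ j) *\<^sub>R axis j 1" by (simp add: w_def)
      moreover have "y \<noteq> axis j 1" using j by (simp add: M_def y_def)
      ultimately have ym: "y $ j = -1"
        using ww True by (metis add.right_neutral norm_zero power2_eq_1_iff scaleR_one zero_eq_power2)
      \<comment> \<open>Otherwise \<open>U\<close> would be diagonal with a single entry \<open>-1\<close>, of determinant \<open>-1\<close>.\<close>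
      have "\<exists>l. l \<in> M \<and> l \<noteq> j"
      proof (rule ccontr)
        assume "\<not> ?thesis"
        then have M: "M = {j}" using j by blast
        have ent: "U $ a $ b = (if a = b then if b = j then -1 else 1 else 0)" for a b
        proof (cases "b = j")
          case True
          have "U $ a $ j = y $ a"
            by (simp add: y_def matrix_vector_mult_basis column_def)
          also have "\<dots> = (if a = j then -1 else 0)"
            by (subst yj) (simp add: ym axis_def)
          finally show ?thesis unfolding True by simp
        next
          case False
          then have "b \<notin> M" using M by simp
          then have "U *v axis b 1 = axis b 1" by (simp add: M_def)
          moreover have "(U *v axis b 1) $ a = U $ a $ b"
            by (simp add: matrix_vector_mult_basis column_def)
          ultimately have "U $ a $ b = axis b 1 $ a" by simp
          then show ?thesis using False by (auto simp: axis_def)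
        qed
        have "det U = (\<Prod>i\<in>UNIV. U $ i $ i)"
          by (rule det_diagonal) (simp add: ent)
        also have "\<dots> = -1"
          by (simp add: ent)
        finally show False using less.prems by (simp add: SO_iff)
      qed
      then obtain l where l: "l \<in> M" "l \<noteq> j" by blast
      show ?thesis
      proof (rule that)
        show "y = cos pi *\<^sub>R axis j 1 + sin pi *\<^sub>R axis l 1"
          by (subst yj) (simp add: ym)
        show "axis l (1::real) $ j = 0" "\<And>i. i \<notin> M \<Longrightarrow> axis l (1::real) $ i = 0"
          using l by (auto simp: axis_def)
      qed simp
    qed
    define G where "G = plane_rotation (axis j 1) q \<theta>"
    have hyp: "norm (axis j (1::real)) = 1" "norm q = 1" "axis j 1 \<bullet> q = 0"
      using q by (auto simp: inner_axis')
    have G: "G \<in> SO" "C1_joined_to_id G"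
      unfolding G_def using plane_rotation_in_SO[OF hyp] C1_joined_to_id_plane_rotation[OF hyp] by auto
    have Gj: "G *v axis j 1 = y"
      unfolding G_def plane_rotation_mult_vec y using q(2)
      by (simp add: inner_axis inner_axis_axis algebra_simps)
    have Gi: "G *v axis i 1 = axis i 1" if "i \<notin> M" for i
    proof -
      have "axis j (1::real) $ i = 0" using that j by (auto simp: axis_def)
      then show ?thesis
        using q(3)[OF that] unfolding G_def plane_rotation_mult_vec by (simp add: inner_axis)
    qed
    have inv: "transpose G *v (G *v x) = x" for x
      by (simp add: matrix_vector_mul_assoc SO_transpose_mult[OF G(1)])
    define U' where "U' = transpose G ** U"
    have U'j: "U' *v axis j 1 = axis j 1"
      using inv[of "axis j 1"] by (simp add: U'_def Gj y_def flip: matrix_vector_mul_assoc)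
    have U'i: "U' *v axis i 1 = axis i 1" if "i \<notin> M" for i
      using inv[of "axis i 1"] that Gi[OF that] by (simp add: U'_def M_def flip: matrix_vector_mul_assoc)
    have "{i. U' *v axis i 1 \<noteq> axis i 1} \<subset> M"
      using U'j U'i j by auto
    then have "card {i. U' *v axis i 1 \<noteq> axis i 1} < card {i. U *v axis i 1 \<noteq> axis i 1}"
      unfolding M_def by (intro psubset_card_mono) auto
    moreover have "U' \<in> SO"
      unfolding U'_def by (intro SO_mult SO_transpose G less.prems)
    ultimately have "C1_joined_to_id U'"
      by (rule less.hyps)
    moreover have "U = G ** U'"
      by (simp add: U'_def matrix_mul_assoc SO_mult_transpose[OF G(1)])
    ultimately show ?thesis
      using C1_joined_to_id_mult[OF G(2)] by simp
  qed
qed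

section \<open>Paths of finite length\<close>

definition connecting_path ::
  "'a::real_normed_vector set \<Rightarrow> ('a \<Rightarrow> 'a \<Rightarrow> 'a \<Rightarrow> real) \<Rightarrow> 'a \<Rightarrow> 'a \<Rightarrow> (real \<Rightarrow> 'a) \<Rightarrow> bool" where
  "connecting_path S g a b \<gamma> \<longleftrightarrow> valid_path \<gamma> \<and> riem_speed g \<gamma> integrable_on {0..1} \<and>
     path_image \<gamma> \<subseteq> S \<and> pathstart \<gamma> = a \<and> pathfinish \<gamma> = b"

lemma riem_dist_connecting_path:
  "riem_dist S g a b = Inf {riem_length g \<gamma> | \<gamma>. connecting_path S g a b \<gamma>}"
  unfolding riem_dist_def connecting_path_def ..

text \<open>
  In a conditionally complete order an infimum is a lower bound only of a set that is bounded below.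
  Lengths are not nonnegative by definition: \<^const>\<open>sqrt\<close> is negative at negative arguments, and
  \<open>g x v v\<close> is known to be nonnegative only for tangent \<open>v\<close>.  Hence the second assumption.
\<close>

lemma riem_dist_le:
  assumes "connecting_path S g a b \<gamma>"
    and "\<And>\<delta>. connecting_path S g a b \<delta> \<Longrightarrow> 0 \<le> riem_length g \<delta>"
  shows "riem_dist S g a b \<le> riem_length g \<gamma>"
  unfolding riem_dist_connecting_path
  by (rule cInf_lower) (use assms in \<open>auto intro!: bdd_belowI[of _ 0]\<close>)

text \<open>
  The assumption that some connecting path exists is essential, as the infimum of the empty set
  is an unspecified real number.
\<close>

lemma le_riem_dist:
  assumes "connecting_path S g a b \<gamma>"
    and "\<And>\<delta>. connecting_path S g a b \<delta> \<Longrightarrow> c \<le> riem_length g \<delta>"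
  shows "c \<le> riem_dist S g a b"
  unfolding riem_dist_connecting_path
  by (rule cInf_greatest) (use assms in auto)

lemma connecting_path_mem:
  assumes "connecting_path S g a b \<gamma>" "t \<in> {0..1}"
  shows "\<gamma> t \<in> S"
  using assms by (auto simp: connecting_path_def path_image_def)

text \<open>
  The end points of the parameter interval are put among the exceptional points, so that every
  regular parameter is interior.  There, any identity that holds along the path can be differentiated.
\<close>

lemma connecting_path_regular:
  assumes "connecting_path S g a b \<gamma>"
  obtains K where "finite K" "0 \<in> K" "1 \<in> K"
    "\<And>t. t \<in> {0..1} - K \<Longrightarrow> (\<gamma> has_vector_derivative vector_derivative \<gamma> (at t)) (at t)"
    "continuous_on ({0..1} - K) (\<lambda>t. vector_derivative \<gamma> (at t))"
proof -
  obtain K where K: "finite K" "\<gamma> C1_differentiable_on ({0..1} - K)"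
    using assms by (auto simp: connecting_path_def valid_path_def piecewise_C1_differentiable_on_def)
  show ?thesis
  proof (rule that[of "insert 0 (insert 1 K)"])
    have "\<gamma> C1_differentiable_on ({0..1} - insert 0 (insert 1 K))"
      by (rule C1_differentiable_on_subset[OF K(2)]) auto
    then show "\<And>t. t \<in> {0..1} - insert 0 (insert 1 K) \<Longrightarrow> (\<gamma> has_vector_derivative vector_derivative \<gamma> (at t)) (at t)"
      "continuous_on ({0..1} - insert 0 (insert 1 K)) (\<lambda>t. vector_derivative \<gamma> (at t))"
      by (auto simp: C1_differentiable_on_eq vector_derivative_works)
  qed (use K in auto)
qed

lemma connecting_path_continuous:
  "connecting_path S g a b \<gamma> \<Longrightarrow> continuous_on {0..1} \<gamma>"
  by (simp add: connecting_path_def valid_path_def piecewise_C1_differentiable_on_def)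

lemma integral_le_off_finite:
  fixes f g :: "real \<Rightarrow> real"
  assumes "finite K" "f integrable_on S" "g integrable_on S"
    and "\<And>t. t \<in> S - K \<Longrightarrow> f t \<le> g t"
  shows "integral S f \<le> integral S g"
proof -
  let ?h = "\<lambda>t. if t \<in> K then g t else f t"
  have "integral S f = integral S ?h"
    by (rule integral_spike[of K]) (use assms(1) in \<open>auto intro: negligible_finite\<close>)
  also have "\<dots> \<le> integral S g"
  proof (rule integral_le)
    show "?h integrable_on S"
      by (rule integrable_spike_finite[OF assms(1) _ assms(2)]) auto
  qed (use assms in auto)
  finally show ?thesis .
qed

lemma C1_connecting_path:
  assumes "\<And>t. t \<in> {0..1} \<Longrightarrow> (\<gamma> has_vector_derivative \<gamma>' t) (at t)"
    and "continuous_on {0..1} \<gamma>'"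
    and "continuous_on {0..1} (\<lambda>t. sqrt (g (\<gamma> t) (\<gamma>' t) (\<gamma>' t)))"
    and "\<And>t. t \<in> {0..1} \<Longrightarrow> \<gamma> t \<in> S"
  shows "connecting_path S g (\<gamma> 0) (\<gamma> 1) \<gamma>"
  unfolding connecting_path_def
proof (intro conjI)
  have "\<gamma> C1_differentiable_on {0..1}"
    using assms(1,2) unfolding C1_differentiable_on_def by blast
  then show "valid_path \<gamma>"
    unfolding valid_path_def by (rule C1_differentiable_imp_piecewise)
  have "continuous_on {0..1} (riem_speed g \<gamma>)"
    by (rule continuous_on_eq[OF assms(3)]) (simp add: riem_speed_def vector_derivative_at[OF assms(1)])
  then show "riem_speed g \<gamma> integrable_on {0..1}"
    by (rule integrable_continuous_interval)
qed (use assms(4) in \<open>auto simp: path_image_def pathstart_def pathfinish_def\<close>)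

section \<open>Tangent vectors and the two metrics\<close>

lemma bounded_linear_entry: "bounded_linear (\<lambda>X :: real^'n^'m. X $ i $ j)"
  by (rule bounded_linear_compose[OF bounded_linear_vec_nth bounded_linear_vec_nth])

lemma has_vector_derivative_zero_of_constant:
  fixes f :: "real \<Rightarrow> 'a::real_normed_vector"
  assumes "(f has_vector_derivative f') (at t)" "0 < t" "t < 1"
    and "\<And>s. s \<in> {0..1} \<Longrightarrow> f s = c"
  shows "f' = 0"
proof -
  have "(f has_vector_derivative 0) (at t)"
    by (rule has_vector_derivative_transform_within_open[of "\<lambda>_. c" _ _ "{0<..<1}"])
      (use assms in auto)
  with assms(1) show ?thesis by (rule vector_derivative_unique_at)
qed

text \<open>
  Differentiate \<open>\<gamma>\<^sup>T \<gamma> = 1\<close>.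
\<close>

lemma SO_tangent_skew:
  fixes \<gamma> :: "real \<Rightarrow> real^'n^'n"
  assumes "(\<gamma> has_vector_derivative A) (at t)" "0 < t" "t < 1"
    and "\<And>s. s \<in> {0..1} \<Longrightarrow> \<gamma> s \<in> SO"
  shows "transpose (transpose (\<gamma> t) ** A) = - (transpose (\<gamma> t) ** A)"
proof -
  have "((\<lambda>s. transpose (\<gamma> s) ** \<gamma> s) has_vector_derivative
      transpose (\<gamma> t) ** A + transpose A ** \<gamma> t) (at t)"
    by (intro bounded_bilinear.has_vector_derivative[OF bounded_bilinear_matrix_mult]
        bounded_linear.has_vector_derivative[OF bounded_linear_transpose] assms(1))
  then have "transpose (\<gamma> t) ** A + transpose A ** \<gamma> t = 0"
    by (rule has_vector_derivative_zero_of_constant[where c = "mat 1"])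
      (use assms in \<open>auto simp: SO_transpose_mult\<close>)
  then show ?thesis
    by (simp add: matrix_transpose_mul eq_neg_iff_add_eq_0 add.commute)
qed

lemma g_SO_nonneg:
  assumes "transpose (transpose U ** A) = - (transpose U ** A)"
  shows "0 \<le> g_SO U A A"
proof -
  define S where "S = transpose U ** A"
  have S: "S $ i $ j * S $ j $ i = - (S $ i $ j)\<^sup>2" for i j
  proof -
    have "transpose S $ i $ j = (- S) $ i $ j"
      using assms unfolding S_def by (rule arg_cong)
    then show ?thesis by (simp add: transpose_def power2_eq_square)
  qed
  have "trace (S ** S) = (\<Sum>i\<in>UNIV. \<Sum>j\<in>UNIV. S $ i $ j * S $ j $ i)"
    by (simp add: trace_def matrix_matrix_mult_def)
  also have "\<dots> = (\<Sum>i\<in>UNIV. \<Sum>j\<in>UNIV. - (S $ i $ j)\<^sup>2)"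
    by (simp only: S)
  also have "\<dots> \<le> 0"
    by (simp add: sum_nonpos)
  finally show ?thesis by (simp add: g_SO_def g_SO_id_def S_def)
qed

lemma continuous_on_g_SO:
  fixes f h :: "'a::topological_space \<Rightarrow> real^'n^'n"
  assumes "continuous_on S f" "continuous_on S h"
  shows "continuous_on S (\<lambda>t. g_SO (f t) (h t) (h t))"
  unfolding g_SO_def g_SO_id_def trace_def
  by (intro continuous_intros bounded_bilinear.continuous_on[OF bounded_bilinear_matrix_mult]
      bounded_linear.continuous_on[OF bounded_linear_transpose] assms)

lemma matrix_mult_diag_right:
  fixes A D :: "real^'n^'n"
  assumes "\<And>i j. i \<noteq> j \<Longrightarrow> D $ i $ j = 0"
  shows "(A ** D) $ i $ j = A $ i $ j * D $ j $ j"
proof -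
  have "(A ** D) $ i $ j = (\<Sum>k\<in>UNIV. if k = j then A $ i $ j * D $ j $ j else 0)"
    unfolding matrix_matrix_mult_def by (simp only: vec_lambda_beta, rule sum.cong) (auto simp: assms)
  then show ?thesis by simp
qed

lemma matrix_mult_diag_left:
  fixes A D :: "real^'n^'n"
  assumes "\<And>i j. i \<noteq> j \<Longrightarrow> D $ i $ j = 0"
  shows "(D ** A) $ i $ j = D $ i $ i * A $ i $ j"
proof -
  have "(D ** A) $ i $ j = (\<Sum>k\<in>UNIV. if k = i then D $ i $ i * A $ i $ j else 0)"
    unfolding matrix_matrix_mult_def by (simp only: vec_lambda_beta, rule sum.cong) (auto simp: assms)
  then show ?thesis by simp
qed

lemma matrix_inv_DiagPos:
  fixes D :: "real^'n^'n"
  assumes "D \<in> DiagPos"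
  shows "matrix_inv D = (\<chi> i j. if i = j then 1 / D $ i $ i else 0)" (is "_ = ?E")
proof -
  have D: "\<And>i j. i \<noteq> j \<Longrightarrow> D $ i $ j = 0" "\<And>i. D $ i $ i \<noteq> 0"
    using assms by (auto simp: DiagPos_def less_le)
  have E: "D ** ?E = mat 1" "?E ** D = mat 1"
    by (auto simp: vec_eq_iff matrix_mult_diag_left[OF D(1)] matrix_mult_diag_right[OF D(1)] mat_def D)
  then have "D ** matrix_inv D = mat 1 \<and> matrix_inv D ** D = mat 1"
    unfolding matrix_inv_def
    by (intro someI[of "\<lambda>A'. D ** A' = mat 1 \<and> A' ** D = mat 1" ?E] conjI)
  then have "matrix_inv D ** (D ** ?E) = ?E"
    by (simp add: matrix_mul_assoc)
  then show ?thesis by (simp add: E(1))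
qed

lemma g_Diag_eq_sum:
  fixes D L :: "real^'n^'n"
  assumes "D \<in> DiagPos" "\<And>i j. i \<noteq> j \<Longrightarrow> L $ i $ j = 0"
  shows "g_Diag D L L = (\<Sum>i\<in>UNIV. (L $ i $ i / D $ i $ i)\<^sup>2)"
proof -
  have "g_Diag D L L = (\<Sum>i\<in>UNIV. (matrix_inv D ** L ** matrix_inv D ** L) $ i $ i)"
    by (simp add: g_Diag_def trace_def)
  also have "\<dots> = (\<Sum>i\<in>UNIV. (L $ i $ i / D $ i $ i)\<^sup>2)"
    unfolding matrix_inv_DiagPos[OF assms(1)]
    by (simp add: matrix_mult_diag_left matrix_mult_diag_right assms(2) power2_eq_square)
  finally show ?thesis .
qed

text \<open>
  This is what makes the infima defining \<^const>\<open>d_SO\<close> and \<^const>\<open>d_M\<close> meaningful.  On the orthogonal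
  factor a path from the identity to \<open>U\<^sup>T V\<close> is translated by \<open>U\<close>; the diagonal factor is convex, so a
  straight segment serves.
\<close>

lemma connecting_path_exists:
  assumes "U \<in> SO" "V \<in> SO" "D \<in> DiagPos" "\<Lambda> \<in> DiagPos"
  shows "\<exists>\<gamma>. connecting_path SO g_SO U V \<gamma>"
    and "\<exists>\<gamma>. connecting_path M_space (g_M k) (U, D) (V, \<Lambda>) \<gamma>"
proof -
  have "C1_joined_to_id (transpose U ** V)"
    by (intro C1_joined_to_id_SO SO_mult SO_transpose assms)
  then obtain c where c: "c C1_differentiable_on UNIV" "\<And>t. c t \<in> SO"
    "c 0 = mat 1" "c 1 = transpose U ** V"
    unfolding C1_joined_to_id_def by blast
  define \<gamma> where "\<gamma> t = U ** c t" for t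
  have "\<gamma> C1_differentiable_on UNIV"
    unfolding \<gamma>_def by (intro C1_differentiable_on_matrix_mult c C1_differentiable_on_const)
  then obtain \<gamma>' where \<gamma>': "\<And>t. (\<gamma> has_vector_derivative \<gamma>' t) (at t)" "continuous_on UNIV \<gamma>'"
    unfolding C1_differentiable_on_def by blast
  have \<gamma>SO: "\<gamma> t \<in> SO" for t
    unfolding \<gamma>_def by (intro SO_mult c assms)
  have ends: "\<gamma> 0 = U" "\<gamma> 1 = V"
    by (simp_all add: \<gamma>_def c matrix_mul_assoc SO_mult_transpose assms)
  have cont: "continuous_on {0..1} \<gamma>" "continuous_on {0..1} \<gamma>'"
    by (blast intro: continuous_at_imp_continuous_on has_vector_derivative_continuous \<gamma>'(1))
      (rule continuous_on_subset[OF \<gamma>'(2)], simp)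
  have "connecting_path SO g_SO (\<gamma> 0) (\<gamma> 1) \<gamma>"
    by (rule C1_connecting_path[of _ \<gamma>'])
      (use \<gamma>' \<gamma>SO cont in \<open>auto intro!: continuous_on_real_sqrt continuous_on_g_SO\<close>)
  then show "\<exists>\<gamma>. connecting_path SO g_SO U V \<gamma>" using ends by auto
  define \<delta> where "\<delta> t = D + t *\<^sub>R (\<Lambda> - D)" for t :: real
  have \<delta>': "(\<delta> has_vector_derivative \<Lambda> - D) (at t)" for t
    unfolding \<delta>_def by (auto intro!: derivative_eq_intros)
  have \<delta>ii: "\<delta> t $ i $ i > 0" if "t \<in> {0..1}" for t i
  proof -
    have "0 < (1 - t) * D $ i $ i + t * \<Lambda> $ i $ i"
    proof (cases "t = 0")
      case True
      then show ?thesis using assms(3) by (simp add: DiagPos_def)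
    next
      case False
      have "0 < D $ i $ i" "0 < \<Lambda> $ i $ i" using assms(3,4) by (auto simp: DiagPos_def)
      then show ?thesis
        using that False by (intro add_nonneg_pos mult_nonneg_nonneg mult_pos_pos) auto
    qed
    then show ?thesis by (simp add: \<delta>_def algebra_simps)
  qed
  then have \<delta>pos: "\<delta> t \<in> DiagPos" if "t \<in> {0..1}" for t
    using that assms(3,4) unfolding DiagPos_def by (auto simp: \<delta>_def)
  have contg: "continuous_on {0..1} (\<lambda>t. g_M k (\<gamma> t, \<delta> t) (\<gamma>' t, \<Lambda> - D) (\<gamma>' t, \<Lambda> - D))"
  proof (rule continuous_on_eq)
    show "continuous_on {0..1} (\<lambda>t. k * g_SO (\<gamma> t) (\<gamma>' t) (\<gamma>' t)
        + (\<Sum>i\<in>UNIV. ((\<Lambda> - D) $ i $ i / (D $ i $ i + t * ((\<Lambda> - D) $ i $ i)))\<^sup>2))"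
      by (intro continuous_intros continuous_on_g_SO cont)
        (use \<delta>ii in \<open>auto simp: \<delta>_def less_le\<close>)
    show "k * g_SO (\<gamma> t) (\<gamma>' t) (\<gamma>' t)
        + (\<Sum>i\<in>UNIV. ((\<Lambda> - D) $ i $ i / (D $ i $ i + t * ((\<Lambda> - D) $ i $ i)))\<^sup>2)
        = g_M k (\<gamma> t, \<delta> t) (\<gamma>' t, \<Lambda> - D) (\<gamma>' t, \<Lambda> - D)" if "t \<in> {0..1}" for t
    proof -
      have "g_Diag (\<delta> t) (\<Lambda> - D) (\<Lambda> - D) = (\<Sum>i\<in>UNIV. ((\<Lambda> - D) $ i $ i / \<delta> t $ i $ i)\<^sup>2)"
        by (rule g_Diag_eq_sum[OF \<delta>pos[OF that]]) (use assms(3,4) in \<open>auto simp: DiagPos_def\<close>)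
      then show ?thesis by (simp add: g_M_def \<delta>_def)
    qed
  qed
  have "connecting_path M_space (g_M k) (\<gamma> 0, \<delta> 0) (\<gamma> 1, \<delta> 1) (\<lambda>t. (\<gamma> t, \<delta> t))"
    by (rule C1_connecting_path[of _ "\<lambda>t. (\<gamma>' t, \<Lambda> - D)"])
      (use \<gamma>' \<gamma>SO cont contg \<delta>' \<delta>pos in \<open>auto simp: M_space_def intro!: continuous_on_real_sqrt
        has_vector_derivative_Pair continuous_on_Pair continuous_on_const\<close>)
  moreover have "\<delta> 0 = D" "\<delta> 1 = \<Lambda>" by (simp_all add: \<delta>_def)
  ultimately show "\<exists>\<gamma>. connecting_path M_space (g_M k) (U, D) (V, \<Lambda>) \<gamma>" using ends by auto
qed

section \<open>Bounds for the length of paths\<close>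

lemma has_vector_derivative_fst_snd:
  assumes "(\<gamma> has_vector_derivative v) (at t)"
  shows "((\<lambda>s. fst (\<gamma> s)) has_vector_derivative fst v) (at t)"
    and "((\<lambda>s. snd (\<gamma> s)) has_vector_derivative snd v) (at t)"
  by (rule bounded_linear.has_vector_derivative[OF bounded_linear_fst assms]
      bounded_linear.has_vector_derivative[OF bounded_linear_snd assms])+

text \<open>
  Tangency splits the squared speed into two nonnegative parts.  Each of the two lower bounds for the
  length below comes from dropping one of them.
\<close>

lemma M_path_regular:
  fixes a b :: "(real^'n^'n) \<times> (real^'n^'n)"
  assumes "connecting_path M_space (g_M k) a b \<gamma>"
  obtains K where "finite K" "0 \<in> K" "1 \<in> K"
    "\<And>t. t \<in> {0..1} - K \<Longrightarrow> (\<gamma> has_vector_derivative vector_derivative \<gamma> (at t)) (at t)"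
    "continuous_on ({0..1} - K) (\<lambda>t. vector_derivative \<gamma> (at t))"
    "\<And>t. t \<in> {0..1} - K \<Longrightarrow>
       0 \<le> g_SO (fst (\<gamma> t)) (fst (vector_derivative \<gamma> (at t))) (fst (vector_derivative \<gamma> (at t)))"
    "\<And>t. t \<in> {0..1} - K \<Longrightarrow> riem_speed (g_M k) \<gamma> t =
       sqrt (k * g_SO (fst (\<gamma> t)) (fst (vector_derivative \<gamma> (at t))) (fst (vector_derivative \<gamma> (at t)))
         + (\<Sum>i\<in>UNIV. (snd (vector_derivative \<gamma> (at t)) $ i $ i / snd (\<gamma> t) $ i $ i)\<^sup>2))"
proof -
  obtain K where K: "finite K" "0 \<in> K" "1 \<in> K"
    "\<And>t. t \<in> {0..1} - K \<Longrightarrow> (\<gamma> has_vector_derivative vector_derivative \<gamma> (at t)) (at t)"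
    "continuous_on ({0..1} - K) (\<lambda>t. vector_derivative \<gamma> (at t))"
    using connecting_path_regular[OF assms] by blast
  have mem: "fst (\<gamma> s) \<in> SO" "snd (\<gamma> s) \<in> DiagPos" if "s \<in> {0..1}" for s
    using connecting_path_mem[OF assms that] by (auto simp: M_space_def mem_Times_iff)
  have open01: "0 < t" "t < 1" if "t \<in> {0..1} - K" for t
    using that K(2,3) by (auto simp: less_le)
  show ?thesis
  proof (rule that[OF K])
    fix t assume t: "t \<in> {0..1} - K"
    define v where "v = vector_derivative \<gamma> (at t)"
    have v: "((\<lambda>s. fst (\<gamma> s)) has_vector_derivative fst v) (at t)"
      "((\<lambda>s. snd (\<gamma> s)) has_vector_derivative snd v) (at t)"
      unfolding v_def by (intro has_vector_derivative_fst_snd K(4) t)+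
    show "0 \<le> g_SO (fst (\<gamma> t)) (fst (vector_derivative \<gamma> (at t))) (fst (vector_derivative \<gamma> (at t)))"
      unfolding v_def[symmetric]
      by (rule g_SO_nonneg[OF SO_tangent_skew[OF v(1) open01[OF t] mem(1)]])
    have "snd v $ i $ j = 0" if "i \<noteq> j" for i j
    proof (rule has_vector_derivative_zero_of_constant)
      show "((\<lambda>s. snd (\<gamma> s) $ i $ j) has_vector_derivative snd v $ i $ j) (at t)"
        by (rule bounded_linear.has_vector_derivative[OF bounded_linear_entry v(2)])
      show "snd (\<gamma> s) $ i $ j = 0" if "s \<in> {0..1}" for s
        using mem(2)[OF that] \<open>i \<noteq> j\<close> by (simp add: DiagPos_def)
    qed (rule open01[OF t])+
    moreover have "t \<in> {0..1}" using t by blast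
    ultimately have "g_Diag (snd (\<gamma> t)) (snd v) (snd v) = (\<Sum>i\<in>UNIV. (snd v $ i $ i / snd (\<gamma> t) $ i $ i)\<^sup>2)"
      by (intro g_Diag_eq_sum mem(2))
    then show "riem_speed (g_M k) \<gamma> t =
       sqrt (k * g_SO (fst (\<gamma> t)) (fst (vector_derivative \<gamma> (at t))) (fst (vector_derivative \<gamma> (at t)))
         + (\<Sum>i\<in>UNIV. (snd (vector_derivative \<gamma> (at t)) $ i $ i / snd (\<gamma> t) $ i $ i)\<^sup>2))"
      unfolding v_def[symmetric] riem_speed_def g_M_def by simp
  qed
qed

lemma SO_length_nonneg:
  assumes "connecting_path SO g_SO U V \<gamma>"
  shows "0 \<le> riem_length g_SO \<gamma>"
proof -
  obtain K where K: "finite K" "0 \<in> K" "1 \<in> K"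
    "\<And>t. t \<in> {0..1} - K \<Longrightarrow> (\<gamma> has_vector_derivative vector_derivative \<gamma> (at t)) (at t)"
    by (rule connecting_path_regular[OF assms]) blast
  have "integral {0..1} (\<lambda>t::real. 0 :: real) \<le> integral {0..1} (riem_speed g_SO \<gamma>)"
  proof (rule integral_le_off_finite[OF K(1)])
    show "0 \<le> riem_speed g_SO \<gamma> t" if t: "t \<in> {0..1} - K" for t
    proof -
      have "0 < t" "t < 1" using t K(2,3) by (auto simp: less_le)
      then have "0 \<le> g_SO (\<gamma> t) (vector_derivative \<gamma> (at t)) (vector_derivative \<gamma> (at t))"
        by (intro g_SO_nonneg SO_tangent_skew[OF K(4)[OF t]] connecting_path_mem[OF assms])
      then show ?thesis by (simp add: riem_speed_def)
    qed
  qed (use assms in \<open>auto simp: connecting_path_def\<close>)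
  then show ?thesis by (simp add: riem_length_def)
qed

text \<open>
  The logarithm of a diagonal entry changes at a rate of at most the speed of the path.  The bound
  also shows that lengths in \<^const>\<open>M_space\<close> are nonnegative.
\<close>

lemma M_length_ge_log:
  fixes a b :: "(real^'n^'n) \<times> (real^'n^'n)"
  assumes "connecting_path M_space (g_M k) a b \<gamma>" "k > 0"
  shows "\<bar>ln (snd b $ i $ i) - ln (snd a $ i $ i)\<bar> \<le> riem_length (g_M k) \<gamma>"
proof -
  obtain K where K: "finite K" "0 \<in> K" "1 \<in> K"
    "\<And>t. t \<in> {0..1} - K \<Longrightarrow> (\<gamma> has_vector_derivative vector_derivative \<gamma> (at t)) (at t)"
    "\<And>t. t \<in> {0..1} - K \<Longrightarrow>
       0 \<le> g_SO (fst (\<gamma> t)) (fst (vector_derivative \<gamma> (at t))) (fst (vector_derivative \<gamma> (at t)))"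
    "\<And>t. t \<in> {0..1} - K \<Longrightarrow> riem_speed (g_M k) \<gamma> t =
       sqrt (k * g_SO (fst (\<gamma> t)) (fst (vector_derivative \<gamma> (at t))) (fst (vector_derivative \<gamma> (at t)))
         + (\<Sum>i\<in>UNIV. (snd (vector_derivative \<gamma> (at t)) $ i $ i / snd (\<gamma> t) $ i $ i)\<^sup>2))"
    by (rule M_path_regular[OF assms(1)]) blast
  have pos: "0 < snd (\<gamma> t) $ i $ i" if "t \<in> {0..1}" for t
    using connecting_path_mem[OF assms(1) that] by (auto simp: M_space_def mem_Times_iff DiagPos_def)
  define f where "f t = ln (snd (\<gamma> t) $ i $ i)" for t
  define f' where "f' t = snd (vector_derivative \<gamma> (at t)) $ i $ i / snd (\<gamma> t) $ i $ i" for t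
  have "(f' has_integral f 1 - f 0) {0..1}"
  proof (rule fundamental_theorem_of_calculus_interior_strong[OF K(1)])
    show "(f has_vector_derivative f' t) (at t)" if "t \<in> {0<..<1} - K" for t
    proof -
      have t: "t \<in> {0..1} - K" using that by auto
      then have "((\<lambda>s. snd (\<gamma> s) $ i $ i) has_vector_derivative snd (vector_derivative \<gamma> (at t)) $ i $ i) (at t)"
        by (intro bounded_linear.has_vector_derivative[OF bounded_linear_entry]
            has_vector_derivative_fst_snd K(4))
      moreover have "0 < snd (\<gamma> t) $ i $ i" using pos t by blast
      ultimately show ?thesis
        unfolding f_def f'_def has_real_derivative_iff_has_vector_derivative[symmetric]
        by (auto intro!: derivative_eq_intros)
    qed
    have "continuous_on {0..1} (\<lambda>t. snd (\<gamma> t) $ i $ i)"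
      by (intro continuous_intros connecting_path_continuous[OF assms(1)])
    then show "continuous_on {0..1} f"
      unfolding f_def using pos by (intro continuous_on_ln) (auto simp: less_le)
  qed simp
  then have f': "f' integrable_on {0..1}" "integral {0..1} f' = f 1 - f 0"
    by (auto simp: has_integral_iff)
  have bound: "\<bar>f' t\<bar> \<le> riem_speed (g_M k) \<gamma> t" if t: "t \<in> {0..1} - K" for t
  proof -
    have "\<bar>f' t\<bar> = sqrt ((f' t)\<^sup>2)" by simp
    also have "\<dots> \<le> riem_speed (g_M k) \<gamma> t"
      unfolding K(6)[OF t]
    proof (rule real_sqrt_le_mono)
      have "(f' t)\<^sup>2 \<le> (\<Sum>i\<in>UNIV. (snd (vector_derivative \<gamma> (at t)) $ i $ i / snd (\<gamma> t) $ i $ i)\<^sup>2)"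
        unfolding f'_def by (rule member_le_sum) auto
      then show "(f' t)\<^sup>2 \<le> k * g_SO (fst (\<gamma> t)) (fst (vector_derivative \<gamma> (at t))) (fst (vector_derivative \<gamma> (at t)))
          + (\<Sum>i\<in>UNIV. (snd (vector_derivative \<gamma> (at t)) $ i $ i / snd (\<gamma> t) $ i $ i)\<^sup>2)"
        using mult_nonneg_nonneg[of k, OF _ K(5)[OF t]] assms(2) by linarith
    qed
    finally show ?thesis .
  qed
  have int: "riem_speed (g_M k) \<gamma> integrable_on {0..1}"
    using assms(1) by (simp add: connecting_path_def)
  have "integral {0..1} f' \<le> riem_length (g_M k) \<gamma>"
    unfolding riem_length_def
    by (rule integral_le_off_finite[OF K(1) f'(1) int]) (use bound in \<open>auto simp: abs_le_iff\<close>)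
  moreover have "integral {0..1} (\<lambda>t. - f' t) \<le> riem_length (g_M k) \<gamma>"
    unfolding riem_length_def
    by (rule integral_le_off_finite[OF K(1) integrable_neg[OF f'(1)] int]) (use bound in \<open>auto simp: abs_le_iff\<close>)
  moreover have "f 1 = ln (snd b $ i $ i)" "f 0 = ln (snd a $ i $ i)"
    using assms(1) by (auto simp: f_def connecting_path_def pathstart_def pathfinish_def)
  ultimately show ?thesis by (simp add: f'(2) abs_le_iff)
qed

text \<open>
  Project the path to the orthogonal factor and drop the diagonal part of the squared speed.  The
  point that needs care is that the projected path again has integrable speed: off a finite set that
  speed is continuous, hence measurable, and \<open>sqrt k\<close> times it is dominated by the speed of the given
  path.
\<close>

lemma M_length_ge_SO_distance:
  fixes a b :: "(real^'n^'n) \<times> (real^'n^'n)"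
  assumes "connecting_path M_space (g_M k) a b \<gamma>" "k > 0"
  shows "sqrt k * d_SO (fst a) (fst b) \<le> riem_length (g_M k) \<gamma>"
proof -
  obtain K where K: "finite K" "0 \<in> K" "1 \<in> K"
    "\<And>t. t \<in> {0..1} - K \<Longrightarrow> (\<gamma> has_vector_derivative vector_derivative \<gamma> (at t)) (at t)"
    "continuous_on ({0..1} - K) (\<lambda>t. vector_derivative \<gamma> (at t))"
    "\<And>t. t \<in> {0..1} - K \<Longrightarrow>
       0 \<le> g_SO (fst (\<gamma> t)) (fst (vector_derivative \<gamma> (at t))) (fst (vector_derivative \<gamma> (at t)))"
    "\<And>t. t \<in> {0..1} - K \<Longrightarrow> riem_speed (g_M k) \<gamma> t =
       sqrt (k * g_SO (fst (\<gamma> t)) (fst (vector_derivative \<gamma> (at t))) (fst (vector_derivative \<gamma> (at t)))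
         + (\<Sum>i\<in>UNIV. (snd (vector_derivative \<gamma> (at t)) $ i $ i / snd (\<gamma> t) $ i $ i)\<^sup>2))"
    by (rule M_path_regular[OF assms(1)]) blast
  define \<delta> where "\<delta> = fst \<circ> \<gamma>"
  have v\<delta>: "vector_derivative \<delta> (at t) = fst (vector_derivative \<gamma> (at t))" if "t \<in> {0..1} - K" for t
    unfolding \<delta>_def o_def
    by (rule vector_derivative_at[OF has_vector_derivative_fst_snd(1)[OF K(4)[OF that]]])
  define s where "s t = sqrt (g_SO (fst (\<gamma> t)) (fst (vector_derivative \<gamma> (at t))) (fst (vector_derivative \<gamma> (at t))))" for t
  have speed\<delta>: "riem_speed g_SO \<delta> t = s t" if "t \<in> {0..1} - K" for t
    unfolding riem_speed_def v\<delta>[OF that] s_def by (simp add: \<delta>_def)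
  have int: "riem_speed (g_M k) \<gamma> integrable_on {0..1}"
    using assms(1) by (simp add: connecting_path_def)
  have le: "sqrt k * s t \<le> riem_speed (g_M k) \<gamma> t" if t: "t \<in> {0..1} - K" for t
    unfolding K(7)[OF t] s_def real_sqrt_mult[symmetric]
    by (rule real_sqrt_le_mono) (simp add: sum_nonneg)
  have spike: "f integrable_on ({0..1} - K) \<longleftrightarrow> f integrable_on {0..1}" for f :: "real \<Rightarrow> real"
    by (rule integrable_spike_set_eq, rule negligible_subset[OF negligible_finite[OF K(1)]]) auto
  have "(\<lambda>t. sqrt k * s t) integrable_on ({0..1} - K)"
  proof (rule measurable_bounded_by_integrable_imp_integrable)
    show sets: "{0..1} - K \<in> sets lebesgue"
      using K(1) by (intro sets.Diff) (auto intro: negligible_imp_sets negligible_finite)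
    have "continuous_on ({0..1} - K) \<gamma>"
      by (rule continuous_on_subset[OF connecting_path_continuous[OF assms(1)]]) auto
    then have "continuous_on ({0..1} - K) (\<lambda>t. sqrt k * s t)"
      unfolding s_def by (intro continuous_intros continuous_on_g_SO K(5))
    then show "(\<lambda>t. sqrt k * s t) \<in> borel_measurable (lebesgue_on ({0..1} - K))"
      using sets by (rule continuous_imp_measurable_on_sets_lebesgue)
    show "riem_speed (g_M k) \<gamma> integrable_on {0..1} - K"
      unfolding spike by (rule int)
    show "norm (sqrt k * s t) \<le> riem_speed (g_M k) \<gamma> t" if "t \<in> {0..1} - K" for t
      using le[OF that] K(6)[OF that] assms(2) by (simp add: s_def)
  qed
  then have ints: "(\<lambda>t. sqrt k * s t) integrable_on {0..1}"
    unfolding spike .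
  then have "(\<lambda>t. (1 / sqrt k) * (sqrt k * s t)) integrable_on {0..1}"
    by (rule integrable_on_mult_right)
  then have "s integrable_on {0..1}"
    using assms(2) by simp
  with K(1) speed\<delta> have int\<delta>: "riem_speed g_SO \<delta> integrable_on {0..1}"
    by (rule integrable_spike_finite)
  have "valid_path \<delta>"
    unfolding \<delta>_def
    by (rule linear_image_valid_path) (use assms(1) in \<open>auto simp: connecting_path_def linear_fst\<close>)
  then have "connecting_path SO g_SO (fst a) (fst b) \<delta>"
    using int\<delta> assms(1)
    by (auto simp: connecting_path_def \<delta>_def path_image_def pathstart_def pathfinish_def M_space_def)
  then have "d_SO (fst a) (fst b) \<le> riem_length g_SO \<delta>"
    unfolding d_SO_def by (rule riem_dist_le) (rule SO_length_nonneg)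
  then have "sqrt k * d_SO (fst a) (fst b) \<le> sqrt k * riem_length g_SO \<delta>"
    using assms(2) by (intro mult_left_mono) auto
  also have "\<dots> = integral {0..1} (\<lambda>t. sqrt k * riem_speed g_SO \<delta> t)"
    by (simp add: riem_length_def)
  also have "\<dots> \<le> riem_length (g_M k) \<gamma>"
    unfolding riem_length_def
  proof (rule integral_le_off_finite[OF K(1) _ int])
    show "(\<lambda>t. sqrt k * riem_speed g_SO \<delta> t) integrable_on {0..1}"
      by (rule integrable_on_mult_right[OF int\<delta>])
    show "sqrt k * riem_speed g_SO \<delta> t \<le> riem_speed (g_M k) \<gamma> t" if "t \<in> {0..1} - K" for t
      using le[OF that] speed\<delta>[OF that] by simp
  qed
  finally show ?thesis .
qed

text \<open>
  Move the orthogonal factor only: a path in \<^const>\<open>SO\<close>, paired with the constant \<open>D\<close>, has \<open>sqrt k\<close>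
  times its length.
\<close>

lemma d_M_equal_diagonal_le:
  fixes U V :: "real^'n^'n"
  assumes "U \<in> SO" "V \<in> SO" "D \<in> DiagPos" "k > 0"
  shows "d_M k (U, D) (V, D) \<le> sqrt k * d_SO U V"
proof -
  obtain \<gamma>0 where "connecting_path SO g_SO U V \<gamma>0"
    using connecting_path_exists(1)[OF assms(1-3,3)] by blast
  then have "d_M k (U, D) (V, D) / sqrt k \<le> d_SO U V"
    unfolding d_SO_def
  proof (rule le_riem_dist)
    fix \<gamma> assume \<gamma>: "connecting_path SO g_SO U V \<gamma>"
    obtain K where K: "finite K"
      "\<And>t. t \<in> {0..1} - K \<Longrightarrow> (\<gamma> has_vector_derivative vector_derivative \<gamma> (at t)) (at t)"
      "continuous_on ({0..1} - K) (\<lambda>t. vector_derivative \<gamma> (at t))"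
      by (rule connecting_path_regular[OF \<gamma>]) blast
    define \<delta> where "\<delta> t = (\<gamma> t, D)" for t
    have \<delta>': "(\<delta> has_vector_derivative (vector_derivative \<gamma> (at t), 0)) (at t)"
      if "t \<in> {0..1} - K" for t
      unfolding \<delta>_def by (intro has_vector_derivative_Pair K(2) that has_vector_derivative_const)
    have speed: "riem_speed (g_M k) \<delta> t = sqrt k * riem_speed g_SO \<gamma> t" if "t \<in> {0..1} - K" for t
      unfolding riem_speed_def vector_derivative_at[OF \<delta>'[OF that]] real_sqrt_mult[symmetric]
      by (simp add: \<delta>_def g_M_def g_Diag_def trace_def matrix_matrix_mult_def)
    have int: "(\<lambda>t. sqrt k * riem_speed g_SO \<gamma> t) integrable_on {0..1}"
      using \<gamma> by (auto simp: connecting_path_def intro: integrable_on_mult_right)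
    have "connecting_path M_space (g_M k) (U, D) (V, D) \<delta>"
      unfolding connecting_path_def
    proof (intro conjI)
      have "\<delta> C1_differentiable_on {0..1} - K"
        unfolding C1_differentiable_on_def
        by (rule exI[of _ "\<lambda>t. (vector_derivative \<gamma> (at t), 0)"])
          (use \<delta>' K(3) in \<open>auto intro!: continuous_on_Pair\<close>)
      moreover have "continuous_on {0..1} \<delta>"
        unfolding \<delta>_def by (intro continuous_intros connecting_path_continuous[OF \<gamma>])
      ultimately show "valid_path \<delta>"
        unfolding valid_path_def piecewise_C1_differentiable_on_def using K(1) by blast
      show "riem_speed (g_M k) \<delta> integrable_on {0..1}"
        by (rule integrable_spike_finite[OF K(1) speed int])
    qed (use \<gamma> assms in \<open>auto simp: \<delta>_def connecting_path_def path_image_def pathstart_def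
        pathfinish_def M_space_def\<close>)
    then have "d_M k (U, D) (V, D) \<le> riem_length (g_M k) \<delta>"
      unfolding d_M_def
      by (rule riem_dist_le) (rule order_trans[OF abs_ge_zero M_length_ge_log[OF _ assms(4)]])
    also have "\<dots> = integral {0..1} (\<lambda>t. sqrt k * riem_speed g_SO \<gamma> t)"
      unfolding riem_length_def
      by (rule integral_spike[OF negligible_finite[OF K(1)]]) (simp add: speed)
    also have "\<dots> = riem_length g_SO \<gamma> * sqrt k"
      by (simp add: riem_length_def)
    finally show "d_M k (U, D) (V, D) / sqrt k \<le> riem_length g_SO \<gamma>"
      using assms(4) by (simp add: pos_divide_le_eq)
  qed
  then show ?thesis
    using assms(4) by (simp add: pos_divide_le_eq mult.commute)
qed

section \<open>Right invariance\<close>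

lemma g_SO_mult_right:
  assumes "W \<in> SO"
  shows "g_SO (U ** W) (A ** W) (A ** W) = g_SO U A A"
proof -
  let ?S = "transpose U ** A"
  have "transpose (U ** W) ** (A ** W) = transpose W ** (?S ** W)"
    by (simp add: matrix_transpose_mul matrix_mul_assoc)
  moreover have "(transpose W ** (?S ** W)) ** (transpose W ** (?S ** W))
      = transpose W ** (?S ** (W ** transpose W) ** ?S ** W)"
    by (simp only: matrix_mul_assoc)
  moreover have "trace (transpose W ** (?S ** ?S ** W)) = trace (?S ** ?S ** (W ** transpose W))"
    by (subst trace_mul_sym) (simp only: matrix_mul_assoc)
  ultimately show ?thesis
    by (simp add: g_SO_def g_SO_id_def SO_mult_transpose[OF assms])
qed

text \<open>
  Right translation maps paths to paths of the same length.
\<close>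

lemma d_SO_mult_right_le:
  fixes U V W :: "real^'n^'n"
  assumes "U \<in> SO" "V \<in> SO" "W \<in> SO"
  shows "d_SO (U ** W) (V ** W) \<le> d_SO U V"
proof -
  have D: "mat 1 \<in> (DiagPos :: (real^'n^'n) set)" by (simp add: DiagPos_def mat_def)
  obtain \<gamma>0 where "connecting_path SO g_SO U V \<gamma>0"
    using connecting_path_exists(1)[OF assms(1,2) D D] by blast
  then have "d_SO (U ** W) (V ** W) \<le> riem_dist SO g_SO U V"
  proof (rule le_riem_dist)
    fix \<gamma> assume \<gamma>: "connecting_path SO g_SO U V \<gamma>"
    obtain K where K: "finite K"
      "\<And>t. t \<in> {0..1} - K \<Longrightarrow> (\<gamma> has_vector_derivative vector_derivative \<gamma> (at t)) (at t)"
      by (rule connecting_path_regular[OF \<gamma>]) blast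
    have lin: "bounded_linear (\<lambda>X :: real^'n^'n. X ** W)"
      by (rule bounded_bilinear.bounded_linear_left[OF bounded_bilinear_matrix_mult])
    define \<delta> where "\<delta> = (\<lambda>X :: real^'n^'n. X ** W) \<circ> \<gamma>"
    have \<delta>': "(\<delta> has_vector_derivative vector_derivative \<gamma> (at t) ** W) (at t)" if "t \<in> {0..1} - K" for t
      unfolding \<delta>_def o_def by (rule bounded_linear.has_vector_derivative[OF lin K(2)[OF that]])
    have speed: "riem_speed g_SO \<delta> t = riem_speed g_SO \<gamma> t" if "t \<in> {0..1} - K" for t
      unfolding riem_speed_def vector_derivative_at[OF \<delta>'[OF that]]
      by (simp add: \<delta>_def g_SO_mult_right[OF assms(3)])
    have "connecting_path SO g_SO (U ** W) (V ** W) \<delta>"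
      unfolding connecting_path_def
    proof (intro conjI)
      show "valid_path \<delta>"
        unfolding \<delta>_def using \<gamma> bounded_linear.linear[OF lin]
        by (intro linear_image_valid_path) (auto simp: connecting_path_def)
      show "riem_speed g_SO \<delta> integrable_on {0..1}"
        by (rule integrable_spike_finite[OF K(1) speed]) (use \<gamma> in \<open>auto simp: connecting_path_def\<close>)
    qed (use \<gamma> assms in \<open>auto simp: \<delta>_def connecting_path_def path_image_def pathstart_def
        pathfinish_def intro: SO_mult\<close>)
    then have "d_SO (U ** W) (V ** W) \<le> riem_length g_SO \<delta>"
      unfolding d_SO_def by (rule riem_dist_le) (rule SO_length_nonneg)
    also have "\<dots> = riem_length g_SO \<gamma>"
      unfolding riem_length_def
      by (rule integral_spike[OF negligible_finite[OF K(1)]]) (simp add: speed)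
    finally show "d_SO (U ** W) (V ** W) \<le> riem_length g_SO \<gamma>" .
  qed
  then show ?thesis by (simp add: d_SO_def)
qed

section \<open>Fibers over matrices with distinct eigenvalues\<close>

text \<open>
  Comparing entries, \<open>W\<^sub>i\<^sub>j D'\<^sub>j\<^sub>j = D\<^sub>i\<^sub>i W\<^sub>i\<^sub>j\<close>, and column \<open>j\<close> of the orthogonal matrix \<open>W\<close> is nonzero.
\<close>

lemma SO_intertwiner_diagonal_entry:
  fixes W D D' :: "real^'n^'n"
  assumes "W \<in> SO" "D \<in> DiagPos" "D' \<in> DiagPos" "W ** D' = D ** W"
  shows "\<exists>i. D' $ j $ j = D $ i $ i"
proof -
  have diag: "\<And>i j. i \<noteq> j \<Longrightarrow> D $ i $ j = 0" "\<And>i j. i \<noteq> j \<Longrightarrow> D' $ i $ j = 0"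
    using assms(2,3) by (auto simp: DiagPos_def)
  have "(transpose W ** W) $ j $ j = 1"
    using SO_transpose_mult[OF assms(1)] by (simp add: mat_def)
  then have "(\<Sum>i\<in>UNIV. W $ i $ j * W $ i $ j) = 1"
    by (simp add: matrix_matrix_mult_def transpose_def)
  then obtain i where "W $ i $ j \<noteq> 0"
    by (metis (no_types, lifting) mult_zero_left sum.neutral zero_neq_one)
  moreover have "W $ i $ j * D' $ j $ j = D $ i $ i * W $ i $ j"
    using assms(4) matrix_mult_diag_right[OF diag(2), where A = W] matrix_mult_diag_left[OF diag(1), where A = W]
    by metis
  ultimately show ?thesis by auto
qed

text \<open>
  A matrix commuting with a diagonal matrix of distinct entries is itself diagonal, and an orthogonal
  diagonal matrix has diagonal entries \<open>1\<close> or \<open>-1\<close>.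
\<close>

lemma SO_commutes_distinct_diagonal:
  fixes S D :: "real^'n^'n"
  assumes "S \<in> SO" "D \<in> DiagPos" "inj (\<lambda>i. D $ i $ i)" "S ** D = D ** S"
  obtains \<sigma> where "\<sigma> \<in> even_signs" "S = sign_matrix \<sigma>"
proof -
  have diag: "\<And>i j. i \<noteq> j \<Longrightarrow> D $ i $ j = 0"
    using assms(2) by (auto simp: DiagPos_def)
  have off: "S $ i $ j = 0" if "i \<noteq> j" for i j
  proof -
    have "S $ i $ j * D $ j $ j = D $ i $ i * S $ i $ j"
      using assms(4) matrix_mult_diag_right[OF diag, where A = S] matrix_mult_diag_left[OF diag, where A = S]
      by metis
    moreover have "D $ i $ i \<noteq> D $ j $ j" using assms(3) that by (auto dest: injD)
    ultimately show ?thesis by auto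
  qed
  have "transpose S $ i $ j = 0" if "i \<noteq> j" for i j
    using off[of j i] that by (simp add: transpose_def)
  then have "(transpose S ** S) $ i $ i = S $ i $ i * S $ i $ i" for i
    by (subst matrix_mult_diag_left) (simp_all add: transpose_def)
  then have "S $ i $ i * S $ i $ i = 1" for i
    using SO_transpose_mult[OF assms(1)] by (simp add: mat_def)
  then have "S $ i $ i = -1 \<or> S $ i $ i = 1" for i
    by (metis square_eq_1_iff)
  moreover have "(\<Prod>i\<in>UNIV. S $ i $ i) = 1"
    using det_diagonal[of S, OF off] assms(1) by (simp add: SO_iff)
  ultimately show ?thesis
    by (intro that[of "\<lambda>i. S $ i $ i"]) (auto simp: even_signs_def sign_matrix_def vec_eq_iff off)
qed

text \<open>
  Two points of the same fiber of \<^const>\<open>F_map\<close> differ by the rotation \<open>U\<^sup>T U'\<close>, which intertwines their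
  diagonal parts.  This relation is all of the structure of the fibers that
  enters the argument.
\<close>

lemma fiber_intertwiner:
  fixes U U' D D' :: "real^'n^'n"
  assumes "U \<in> SO" "U' \<in> SO" "F_map (U', D') = F_map (U, D)"
  shows "(transpose U ** U') ** D' = D ** (transpose U ** U')"
proof -
  have eq: "U' ** D' ** transpose U' = U ** D ** transpose U"
    using assms(3) by (simp add: F_map_def)
  have "(transpose U ** U') ** D' = transpose U ** (U' ** D' ** (transpose U' ** U'))"
    by (simp add: SO_transpose_mult[OF assms(2)] matrix_mul_assoc)
  also have "\<dots> = transpose U ** (U' ** D' ** transpose U') ** U'"
    by (simp only: matrix_mul_assoc)
  also have "\<dots> = (transpose U ** U) ** D ** transpose U ** U'"
    unfolding eq by (simp only: matrix_mul_assoc)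
  also have "\<dots> = D ** (transpose U ** U')"
    by (simp add: SO_transpose_mult[OF assms(1)] matrix_mul_assoc)
  finally show ?thesis .
qed

text \<open>
  Entries \<open>exp (c h(i))\<close> for an injective numbering \<open>h\<close> of the indices; \<open>c\<close> is raised to at least \<open>1\<close>
  so that separation implies distinctness.
\<close>

lemma distinct_log_separated_diagonal:
  obtains D :: "real^'n^'n" where "D \<in> DiagPos" "inj (\<lambda>i. D $ i $ i)"
    "\<And>i j. i \<noteq> j \<Longrightarrow> c \<le> \<bar>ln (D $ i $ i) - ln (D $ j $ j)\<bar>"
proof -
  obtain h :: "'n \<Rightarrow> nat" where h: "inj h"
    using finite_imp_inj_to_nat_seg[of "UNIV :: 'n set"] by auto
  define c' where "c' = max c 1"
  define D :: "real^'n^'n" where "D = (\<chi> i j. if i = j then exp (c' * real (h i)) else 0)"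
  have sep: "c' \<le> \<bar>ln (D $ i $ i) - ln (D $ j $ j)\<bar>" if "i \<noteq> j" for i j
  proof -
    have "h i \<noteq> h j" using h that by (auto dest: injD)
    then have "1 \<le> \<bar>real (h i) - real (h j)\<bar>" by linarith
    then have "c' * 1 \<le> c' * \<bar>real (h i) - real (h j)\<bar>"
      by (intro mult_left_mono) (simp_all add: c'_def)
    also have "\<dots> = \<bar>ln (D $ i $ i) - ln (D $ j $ j)\<bar>"
      by (simp add: D_def c'_def abs_mult flip: right_diff_distrib)
    finally show ?thesis by simp
  qed
  show ?thesis
  proof (rule that)
    show "D \<in> DiagPos" by (simp add: DiagPos_def D_def)
    show "inj (\<lambda>i. D $ i $ i)"
    proof (rule injI, rule ccontr)
      fix i j assume "D $ i $ i = D $ j $ j" "i \<noteq> j"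
      then show False using sep[of i j] by (simp add: c'_def)
    qed
    show "c \<le> \<bar>ln (D $ i $ i) - ln (D $ j $ j)\<bar>" if "i \<noteq> j" for i j
      using sep[OF that] by (simp add: c'_def)
  qed
qed

section \<open>Minimal pairs from irreducible pairs of rotations\<close>

theorem proposition3p20:
  fixes U V :: "real ^ 'n::finite ^ 'n" and k :: real
  assumes "CARD('n) \<ge> 2"
    and "k > 0"
    and "U \<in> SO" and "V \<in> SO"
    and "\<not> sign_change_reducible U V"
  shows "\<exists>D \<in> DiagPos. \<exists>\<Lambda> \<in> DiagPos.
           inj (\<lambda>i. D $ i $ i) \<and> inj (\<lambda>i. \<Lambda> $ i $ i) \<and>
           minimal_pair k (U, D) (V, \<Lambda>)"
proof -
  obtain D :: "real^'n^'n" where D: "D \<in> DiagPos" "inj (\<lambda>i. D $ i $ i)"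
    "\<And>i j. i \<noteq> j \<Longrightarrow> sqrt k * d_SO U V \<le> \<bar>ln (D $ i $ i) - ln (D $ j $ j)\<bar>"
    by (rule distinct_log_separated_diagonal[where c = "sqrt k * d_SO U V"]) blast
  have lower: "sqrt k * d_SO U V \<le> d_M k a b"
    if a: "a \<in> fiber (F_map (U, D))" and b: "b \<in> fiber (F_map (V, D))" for a b
  proof -
    obtain U' D' where a': "a = (U', D')" "U' \<in> SO" "D' \<in> DiagPos" "F_map (U', D') = F_map (U, D)"
      using a by (cases a) (auto simp: fiber_def M_space_def)
    obtain V' \<Lambda>' where b': "b = (V', \<Lambda>')" "V' \<in> SO" "\<Lambda>' \<in> DiagPos" "F_map (V', \<Lambda>') = F_map (V, D)"
      using b by (cases b) (auto simp: fiber_def M_space_def)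
    define W1 W2 where "W1 = transpose U ** U'" and "W2 = transpose V ** V'"
    have W1: "W1 \<in> SO" "W1 ** D' = D ** W1"
      unfolding W1_def using fiber_intertwiner[OF assms(3) a'(2,4)]
      by (auto intro: SO_mult SO_transpose assms a')
    have W2: "W2 \<in> SO" "W2 ** \<Lambda>' = D ** W2"
      unfolding W2_def using fiber_intertwiner[OF assms(4) b'(2,4)]
      by (auto intro: SO_mult SO_transpose assms b')
    obtain \<gamma> where "connecting_path M_space (g_M k) a b \<gamma>"
      using connecting_path_exists(2)[OF a'(2) b'(2) a'(3) b'(3)] a'(1) b'(1) by blast
    then show ?thesis
      unfolding d_M_def
    proof (rule le_riem_dist)
      fix \<gamma> assume \<gamma>: "connecting_path M_space (g_M k) a b \<gamma>"
      show "sqrt k * d_SO U V \<le> riem_length (g_M k) \<gamma>"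
      \<comment> \<open>The diagonal parts of the two end points either differ, and then the diagonal motion alone is
        long enough, or agree, and then the orthogonal parts differ from \<open>U\<close>, \<open>V\<close> by a sign change and
        a common right translation.\<close>
      proof (cases "\<exists>j. D' $ j $ j \<noteq> \<Lambda>' $ j $ j")
        case True
        then obtain j where j: "D' $ j $ j \<noteq> \<Lambda>' $ j $ j" by blast
        obtain i where i: "D' $ j $ j = D $ i $ i"
          using SO_intertwiner_diagonal_entry[OF W1(1) D(1) a'(3) W1(2)] by blast
        obtain l where l: "\<Lambda>' $ j $ j = D $ l $ l"
          using SO_intertwiner_diagonal_entry[OF W2(1) D(1) b'(3) W2(2)] by blast
        have "l \<noteq> i" using i l j by auto
        then have "sqrt k * d_SO U V \<le> \<bar>ln (D $ l $ l) - ln (D $ i $ i)\<bar>"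
          by (rule D(3))
        also have "\<dots> = \<bar>ln (snd b $ j $ j) - ln (snd a $ j $ j)\<bar>"
          by (simp add: a' b' i l)
        also have "\<dots> \<le> riem_length (g_M k) \<gamma>"
          by (rule M_length_ge_log[OF \<gamma> assms(2)])
        finally show ?thesis .
      next
        case False
        then have "\<Lambda>' = D'"
          using a'(3) b'(3) by (auto simp: vec_eq_iff DiagPos_def) metis
        then have W2': "W2 ** D' = D ** W2" using W2(2) by simp
        define S where "S = W1 ** transpose W2"
        have "transpose W2 ** D = transpose W2 ** (D ** W2) ** transpose W2"
          by (simp add: SO_mult_transpose[OF W2(1)] flip: matrix_mul_assoc)
        also have "\<dots> = (transpose W2 ** W2) ** D' ** transpose W2"
          by (simp add: matrix_mul_assoc flip: W2')
        finally have "transpose W2 ** D = D' ** transpose W2"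
          by (simp add: SO_transpose_mult[OF W2(1)])
        then have "S ** D = (W1 ** D') ** transpose W2"
          unfolding S_def by (simp flip: matrix_mul_assoc)
        then have "S ** D = D ** S"
          unfolding S_def W1(2) by (simp add: matrix_mul_assoc)
        moreover have "S \<in> SO"
          unfolding S_def by (intro SO_mult SO_transpose W1 W2)
        ultimately obtain \<sigma> where \<sigma>: "\<sigma> \<in> even_signs" "S = sign_matrix \<sigma>"
          using SO_commutes_distinct_diagonal D(1,2) by blast
        have "U ** S = (U ** transpose U) ** U' ** transpose W2"
          by (simp add: S_def W1_def matrix_mul_assoc)
        then have US: "U ** S = U' ** transpose W2"
          by (simp add: SO_mult_transpose[OF assms(3)])
        have "V = V' ** transpose V' ** V"
          by (simp add: SO_mult_transpose[OF b'(2)])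
        then have VS: "V = V' ** transpose W2"
          by (simp add: W2_def matrix_transpose_mul matrix_mul_assoc)
        have "d_SO U V \<le> d_SO (U ** S) V"
          using assms(5) \<sigma> by (auto simp: sign_change_reducible_def not_less)
        also have "\<dots> = d_SO (U' ** transpose W2) (V' ** transpose W2)"
          unfolding US by (subst VS) simp
        also have "\<dots> \<le> d_SO U' V'"
          by (intro d_SO_mult_right_le SO_transpose W2 a' b')
        finally have "sqrt k * d_SO U V \<le> sqrt k * d_SO (fst a) (fst b)"
          using assms(2) by (simp add: a'(1) b'(1))
        also have "\<dots> \<le> riem_length (g_M k) \<gamma>"
          by (rule M_length_ge_SO_distance[OF \<gamma> assms(2)])
        finally show ?thesis .
      qed
    qed
  qed
  have mem: "(U, D) \<in> fiber (F_map (U, D))" "(V, D) \<in> fiber (F_map (V, D))"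
    using assms D by (auto simp: fiber_def M_space_def)
  have "d_SR k (F_map (U, D)) (F_map (V, D)) = d_M k (U, D) (V, D)"
    unfolding d_SR_def
  proof (rule cInf_eq_minimum)
    show "d_M k (U, D) (V, D)
        \<in> {d_M k a b |a b. a \<in> fiber (F_map (U, D)) \<and> b \<in> fiber (F_map (V, D))}"
      using mem by blast
    fix x assume "x \<in> {d_M k a b |a b. a \<in> fiber (F_map (U, D)) \<and> b \<in> fiber (F_map (V, D))}"
    then show "d_M k (U, D) (V, D) \<le> x"
      using order_trans[OF d_M_equal_diagonal_le[OF assms(3,4) D(1) assms(2)] lower] by blast
  qed
  then have "minimal_pair k (U, D) (V, D)"
    using mem by (simp add: minimal_pair_def fiber_def)
  then show ?thesis using D(1,2) by blast
qed

end
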